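(* Let $M\ge 1$ and $L\ge 2$ be integers and let $\mathcal{V}=\{\mathbf{U}_1,\mathbf{U}_2,\dots,\mathbf{U}_L\}$ be a random unitary space time constellation consisting of $L$ independent Haar distributed random matrices in the unitary group $U(M)$. Then $$\Pr\Big(\prod\mathcal{V}=0\Big)=0,$$ that is, $\mathcal{V}$ is fully diverse with probability $1$.
   Context: $U(M)$ denotes the compact group of $M\times M$ complex unitary matrices. The Haar measure $\mathcal{H}$ on $U(M)$ is the translation invariant probability measure: $\mathcal{H}(U_0S)=\mathcal{H}(S)$ for every measurable $S\subset U(M)$ and every $U_0\in U(M)$. A random unitary matrix $\mathbf{U}$ is Haar distributed if $\Pr(\mathbf{U}\in S)=\mathcal{H}(S)$ for every measurable $S\subset U(M)$. For a constellation $\mathcal{V}=\{\Psi_1,\dots,\Psi_L\}$ of $M\times M$ unitary matrices (indexed family), the diversity product is $$\prod\mathcal{V}=\frac12\min_{1\le l<l'\le L}\left|\det(\Psi_l-\Psi_{l'})\right|^{1/M}.$$ The constellation $\mathcal{V}$ is called fully diverse if $\prod\mathcal{V}>0$. *)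

theory Defs
  imports "HOL-Probability.Probability"
begin

text \<open>Matrices of size \<open>M \<times> M\<close> have type \<open>complex^'n^'n\<close>, where \<open>M = CARD('n) \<ge> 1\<close>.\<close>

definition conj_transpose :: "complex^'n^'m \<Rightarrow> complex^'m^'n" where
  "conj_transpose A = map_matrix cnj (transpose A)"

definition unitary_group :: "(complex^'n^'n) set" where
  "unitary_group = {A. conj_transpose A ** A = mat 1 \<and> A ** conj_transpose A = mat 1}"

definition unitary_borel :: "(complex^'n^'n) measure" where
  "unitary_borel = restrict_space borel unitary_group"

definition is_haar_measure :: "(complex^'n^'n) measure \<Rightarrow> bool" where
  "is_haar_measure H \<longleftrightarrow> prob_space H \<and> sets H = sets unitary_borel \<and>
     (\<forall>U0\<in>unitary_group. \<forall>S\<in>sets H. measure H ((\<lambda>A. U0 ** A) ` S) = measure H S)"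

text \<open>A constellation is the family \<open>\<Psi> 1, \<dots>, \<Psi> L\<close>; values of \<open>\<Psi>\<close> outside \<open>{1..L}\<close> are
  irrelevant. The minimum is over a nonempty set exactly when \<open>L \<ge> 2\<close>.\<close>

definition diversity_product :: "nat \<Rightarrow> (nat \<Rightarrow> complex^'n^'n) \<Rightarrow> real" where
  "diversity_product L \<Psi> =
     1/2 * Min {cmod (det (\<Psi> l - \<Psi> l')) powr (1 / real CARD('n)) | l l'. 1 \<le> l \<and> l < l' \<and> l' \<le> L}"

definition fully_diverse :: "nat \<Rightarrow> (nat \<Rightarrow> complex^'n^'n) \<Rightarrow> bool" where
  "fully_diverse L \<Psi> \<longleftrightarrow> diversity_product L \<Psi> > 0"

end

theory Submission
  imports Defs "HOL-Computational_Algebra.Polynomial"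
begin

text \<open>For two independent Haar matrices the difference is singular with probability 0; since a
  constellation has finitely many pairs, full diversity then holds almost surely
  (\<open>diversity_product_pos_iff\<close>). Independence makes the joint law of a pair a product
  measure, so by Fubini one matrix \<open>B\<close> may be frozen
  (\<open>indep_haar_difference_nonsingular\<close>). It remains to see that det(A - B) = 0 has
  probability 0 for Haar distributed A and fixed unitary \<open>B\<close>
  (\<open>haar_singular_difference_null\<close>).

  The tool is rotation by scalars. For |z| = 1 the matrix \<open>mat z\<close> is unitary, so by
  invariance the event det(zA - B) = 0 has a probability p that does not depend on z. For each A,
  however, det(zA - B) is a polynomial in z of degree at most M, nonzero because its value at 0 is
  det(-B) (\<open>card_det_pencil_roots\<close>). Hence at most M of the N-th roots of unity satisfy
  it, and taking expectations gives N p <= M for every N > 0, so p = 0.\<close>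

section \<open>Measurability of determinants and algebra of unitary matrices\<close>

lemma continuous_on_det:
  fixes f :: "'a::topological_space \<Rightarrow> complex^'n^'n"
  assumes "continuous_on S f"
  shows "continuous_on S (\<lambda>x. det (f x))"
  unfolding det_def by (intro continuous_intros assms)

lemma borel_measurable_det [measurable]: "(det :: complex^'n^'n \<Rightarrow> complex) \<in> borel_measurable borel"
  by (intro borel_measurable_continuous_onI continuous_on_det continuous_on_id)

lemma borel_measurable_matrix_mult_left [measurable]:
  fixes C :: "complex^'n^'n"
  shows "(\<lambda>A. C ** A) \<in> borel_measurable borel"
  unfolding matrix_matrix_mult_def
  by (intro borel_measurable_continuous_onI continuous_intros)

lemma space_unitary_borel [simp]: "space unitary_borel = unitary_group"
  by (simp add: unitary_borel_def space_restrict_space)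

lemma measurable_unitary_borel_imp_borel:
  "f \<in> measurable M unitary_borel \<Longrightarrow> f \<in> borel_measurable M"
  unfolding unitary_borel_def by (simp add: measurable_restrict_space2_iff)

lemma conj_transpose_mult:
  fixes A B :: "complex^'n^'n"
  shows "conj_transpose (A ** B) = conj_transpose B ** conj_transpose A"
  by (simp add: conj_transpose_def vec_eq_iff matrix_matrix_mult_def transpose_def mult.commute)

lemma unitary_group_mult:
  assumes "A \<in> unitary_group" "B \<in> unitary_group"
  shows "A ** B \<in> unitary_group"
proof -
  have "conj_transpose B ** conj_transpose A ** (A ** B) = conj_transpose B ** (conj_transpose A ** A) ** B"
    by (simp add: matrix_mul_assoc)
  moreover have "A ** B ** (conj_transpose B ** conj_transpose A) = A ** (B ** conj_transpose B) ** conj_transpose A"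
    by (simp add: matrix_mul_assoc)
  ultimately show ?thesis
    using assms by (simp add: unitary_group_def conj_transpose_mult)
qed

lemma mat_mult_left: "mat a ** A = (\<chi> i j. a * A $ i $ j)" for A :: "complex^'m^'n"
  by (simp add: vec_eq_iff matrix_matrix_mult_def mat_def if_distrib if_distribR cong: if_cong)

lemma mat_mult_mat: "(mat a :: complex^'n^'n) ** mat b = mat (a * b)"
  by (simp add: mat_mult_left vec_eq_iff) (simp add: mat_def)

lemma conj_transpose_mat: "conj_transpose (mat z :: complex^'n^'n) = mat (cnj z)"
  by (simp add: conj_transpose_def vec_eq_iff mat_def transpose_def)

text \<open>Supplies the scalar rotations under which Haar measure is invariant.\<close>

lemma mat_in_unitary_group:
  assumes "cmod z = 1"
  shows "(mat z :: complex^'n^'n) \<in> unitary_group"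
proof -
  have "z * cnj z = 1"
    using assms by (simp add: complex_norm_square [symmetric])
  then show ?thesis
    by (simp add: unitary_group_def conj_transpose_mat mat_mult_mat mult.commute)
qed

lemma det_unitary_nonzero:
  assumes "A \<in> unitary_group"
  shows "det A \<noteq> 0"
proof -
  have "det (conj_transpose A) * det A = 1"
    using assms by (simp add: unitary_group_def flip: det_mul)
  then show ?thesis by auto
qed

section \<open>Scalar rotations and the roots of a matrix pencil\<close>

text \<open>Expanding the determinant by permutations shows it to be a polynomial in
  \<open>z\<close>, each term being a product of \<open>CARD('n)\<close> linear factors.
  Invertibility of \<open>B\<close> excludes the zero polynomial; \<open>A\<close> may be
  arbitrary.\<close>

lemma
  fixes A B :: "complex^'n^'n"
  assumes "det B \<noteq> 0"
  shows finite_det_pencil_roots: "finite {z. det (mat z ** A - B) = 0}"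
    and card_det_pencil_roots: "card {z. det (mat z ** A - B) = 0} \<le> CARD('n)"
proof -
  define p where "p = (\<Sum>\<sigma> | \<sigma> permutes (UNIV :: 'n set).
      smult (of_int (sign \<sigma>)) (\<Prod>i\<in>UNIV. [:- (B $ i $ \<sigma> i), A $ i $ \<sigma> i:]))"
  have poly_p: "poly p z = det (mat z ** A - B)" for z
    by (simp add: p_def det_def poly_sum poly_prod mat_mult_left)
  have "degree p \<le> CARD('n)"
    unfolding p_def
  proof (rule degree_sum_le)
    fix \<sigma> :: "'n \<Rightarrow> 'n"
    have "degree (\<Prod>i\<in>UNIV. [:- (B $ i $ \<sigma> i), A $ i $ \<sigma> i:])
        \<le> (\<Sum>i\<in>UNIV. degree [:- (B $ i $ \<sigma> i), A $ i $ \<sigma> i:])"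
      using degree_prod_sum_le[OF finite, where S = "UNIV :: 'n set" and f = "\<lambda>i. [:- (B $ i $ \<sigma> i), A $ i $ \<sigma> i:]"]
      unfolding o_def .
    also have "\<dots> \<le> (\<Sum>i\<in>(UNIV :: 'n set). 1)"
      by (rule sum_mono) simp
    also have "\<dots> = CARD('n)" by simp
    finally show "degree (smult (of_int (sign \<sigma>)) (\<Prod>i\<in>UNIV. [:- (B $ i $ \<sigma> i), A $ i $ \<sigma> i:])) \<le> CARD('n)"
      by (rule order.trans[OF degree_smult_le])
  qed simp
  \<comment> \<open>The constant coefficient is det(-B), the product of det(-I) and det B, both
    nonzero.\<close>
  moreover have "p \<noteq> 0"
  proof
    assume "p = 0"
    then have "det (0 - B) = 0"
      using poly_p[of 0] by simp
    moreover have "0 - B = mat (- 1) ** B"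
      by (simp add: vec_eq_iff mat_mult_left)
    moreover have "det (mat (- 1) :: complex^'n^'n) \<noteq> 0"
      by (intro det_unitary_nonzero mat_in_unitary_group) simp
    ultimately show False
      using assms by (simp add: det_mul)
  qed
  ultimately show "finite {z. det (mat z ** A - B) = 0}"
    and "card {z. det (mat z ** A - B) = 0} \<le> CARD('n)"
    using poly_roots_finite[of p] card_poly_roots_bound[of p] unfolding poly_p by linarith+
qed

text \<open>By scalar invariance the events \<open>det (z A - B) = 0\<close> with \<open>z\<^sup>N = 1\<close> all have the same
  probability \<open>p\<close>, and at most \<open>M\<close> of these \<open>N\<close> events occur simultaneously; hence \<open>N p \<le> M\<close>.\<close>

lemma haar_singular_difference_null:
  fixes H :: "(complex^'n^'n) measure"
  assumes H: "is_haar_measure H" and B: "B \<in> unitary_group"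
  shows "AE A in H. det (A - B) \<noteq> 0"
proof -
  interpret H: prob_space H
    using H by (simp add: is_haar_measure_def)
  have sets_H: "sets H = sets unitary_borel"
    using H by (simp add: is_haar_measure_def)
  have space_H: "space H = unitary_group"
    using sets_eq_imp_space_eq[OF sets_H] by simp
  have id_meas: "(\<lambda>A. A) \<in> borel_measurable H"
    by (rule measurable_unitary_borel_imp_borel) (simp add: measurable_cong_sets[OF sets_H refl])
  have mult_meas: "(\<lambda>A. C ** A) \<in> borel_measurable H" for C :: "complex^'n^'n"
    using measurable_compose[OF id_meas borel_measurable_matrix_mult_left] .
  define S where "S z = {A \<in> space H. det (mat z ** A - B) = 0}" for z
  have "(\<lambda>A. det (mat z ** A - B)) \<in> borel_measurable H" for z
    using measurable_compose[OF borel_measurable_diff[OF mult_meas measurable_const] borel_measurable_det]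
    by simp
  then have S_sets: "S z \<in> sets H" for z
    unfolding S_def by measurable
  have measure_S: "measure H (S z) = measure H (S 1)" if z: "cmod z = 1" for z
  proof -
    \<comment> \<open>Translation by \<open>mat z\<close> carries one event onto the other; the
      inverse map is translation by \<open>mat (inverse z)\<close>, again unitary.\<close>
    have "(\<lambda>A. mat z ** A) ` S z = S 1"
    proof (intro equalityI subsetI)
      fix A assume "A \<in> (\<lambda>A. mat z ** A) ` S z"
      then show "A \<in> S 1"
        by (auto simp: S_def space_H intro: unitary_group_mult mat_in_unitary_group z)
    next
      fix A assume A: "A \<in> S 1"
      have "z * inverse z = 1"
        using z by (intro right_inverse) auto
      then have "mat z ** (mat (inverse z) ** A) = A"
        by (simp add: matrix_mul_assoc mat_mult_mat)
      moreover have "mat (inverse z) ** A \<in> unitary_group"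
        using A z by (intro unitary_group_mult mat_in_unitary_group) (auto simp: S_def space_H norm_inverse)
      ultimately show "A \<in> (\<lambda>A. mat z ** A) ` S z"
        using A by (intro image_eqI[of _ _ "mat (inverse z) ** A"]) (auto simp: S_def space_H)
    qed
    then show ?thesis
      using H mat_in_unitary_group[OF z] S_sets[of z] unfolding is_haar_measure_def by metis
  qed
  have bound: "real N * measure H (S 1) \<le> real CARD('n)" if "N > 0" for N
  proof -
    \<comment> \<open>Any \<open>N\<close> distinct points of the unit circle would serve; the roots
      of unity are a convenient choice.\<close>
    define Z where "Z = {z::complex. z ^ N = 1}"
    have card_Z: "card Z = N"
      using that by (simp add: Z_def card_roots_unity_eq)
    have fin: "finite Z"
      using card_Z that card_ge_0_finite by blast
    have norm_Z: "cmod z = 1" if "z \<in> Z" for z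
    proof -
      have "cmod z ^ N = 1 ^ N"
        using that by (simp add: Z_def flip: norm_power)
      then show ?thesis
        by (rule power_eq_imp_eq_base) (use \<open>N > 0\<close> in auto)
    qed
    have "(\<Sum>z\<in>Z. measure H (S z)) = (\<Sum>z\<in>Z. measure H (S 1))"
      by (intro sum.cong refl measure_S norm_Z)
    then have "real N * measure H (S 1) = (\<Sum>z\<in>Z. measure H (S z))"
      by (simp add: card_Z)
    \<comment> \<open>The sum of probabilities is the expected number of the events
      \<open>S z\<close> that occur, and this number is bounded pointwise by the root count of the
      pencil.\<close>
    also have "\<dots> = (\<integral>A. (\<Sum>z\<in>Z. indicator (S z) A) \<partial>H)"
      using S_sets by (subst Bochner_Integration.integral_sum) (auto simp: H.emeasure_eq_measure Int_absorb2 sets.sets_into_space)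
    also have "\<dots> \<le> real CARD('n)"
    proof (rule H.integral_le_const)
      show "integrable H (\<lambda>A. \<Sum>z\<in>Z. indicator (S z) A :: real)"
        using S_sets by (auto simp: H.emeasure_eq_measure)
      have "(\<Sum>z\<in>Z. indicator (S z) A) \<le> real CARD('n)" for A
      proof -
        have "(\<Sum>z\<in>Z. indicator (S z) A :: real) = real (card {z\<in>Z. A \<in> S z})"
          using fin by (simp add: indicator_def sum.If_cases Int_def)
        also have "\<dots> \<le> real (card {z. det (mat z ** A - B) = 0})"
          using finite_det_pencil_roots[OF det_unitary_nonzero[OF B]]
          by (intro of_nat_mono card_mono) (auto simp: S_def)
        also have "\<dots> \<le> real CARD('n)"
          using card_det_pencil_roots[OF det_unitary_nonzero[OF B]] by (intro of_nat_mono)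
        finally show ?thesis .
      qed
      then show "AE A in H. (\<Sum>z\<in>Z. indicator (S z) A) \<le> real CARD('n)" by simp
    qed
    finally show ?thesis .
  qed
  have "measure H (S 1) = 0"
  proof (rule ccontr)
    assume "measure H (S 1) \<noteq> 0"
    then have "measure H (S 1) > 0"
      by (simp add: zero_less_measure_iff)
    \<comment> \<open>By the Archimedean property a positive probability would violate
      \<open>bound\<close> for large \<open>N\<close>.\<close>
    then obtain N where N: "real CARD('n) < real N * measure H (S 1)"
      using reals_Archimedean3 by blast
    then have "N > 0" by (cases N) auto
    from bound[OF this] N show False by simp
  qed
  then have "AE A in H. A \<notin> S 1"
    using S_sets by (simp add: AE_iff_measurable[OF _ refl] H.prob_eq_0)
  then show ?thesis
    by (rule AE_mp) (simp add: S_def)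
qed

section \<open>Independent pairs of Haar matrices\<close>

lemma measurable_det_diff:
  fixes X Y :: "'a \<Rightarrow> complex^'n^'n"
  assumes "X \<in> measurable M unitary_borel" "Y \<in> measurable M unitary_borel"
  shows "(\<lambda>\<omega>. det (X \<omega> - Y \<omega>)) \<in> borel_measurable M"
  by (rule measurable_compose[OF borel_measurable_diff borel_measurable_det])
     (intro measurable_unitary_borel_imp_borel assms)+

text \<open>Independence identifies the law of the pair with \<open>H \<Otimes>\<^sub>M H\<close>,
  and almost every slice is handled with the first coordinate fixed. The fixed matrix is thus the
  value of \<open>X\<close>, which is why it is the one subtracted.\<close>

lemma (in prob_space) indep_haar_difference_nonsingular:
  fixes X Y :: "'a \<Rightarrow> complex^'n^'n"
  assumes H: "is_haar_measure H"
    and ind: "indep_var unitary_borel X unitary_borel Y"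
    and X: "distr M unitary_borel X = H" and Y: "distr M unitary_borel Y = H"
  shows "AE \<omega> in M. det (Y \<omega> - X \<omega>) \<noteq> 0"
proof -
  let ?U = "unitary_borel :: (complex^'n^'n) measure"
  interpret H: prob_space H
    using H by (simp add: is_haar_measure_def)
  interpret HH: pair_prob_space H H ..
  have sets_H: "sets H = sets ?U"
    using H by (simp add: is_haar_measure_def)
  have space_H: "space H = unitary_group"
    using sets_eq_imp_space_eq[OF sets_H] by simp
  have rv: "random_variable (?U \<Otimes>\<^sub>M ?U) (\<lambda>\<omega>. (X \<omega>, Y \<omega>))"
    and joint: "H \<Otimes>\<^sub>M H = distr M (?U \<Otimes>\<^sub>M ?U) (\<lambda>\<omega>. (X \<omega>, Y \<omega>))"
    using ind by (auto simp: indep_var_distribution_eq X Y)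
  have meas: "(\<lambda>q. det (snd q - fst q)) \<in> borel_measurable (?U \<Otimes>\<^sub>M ?U)"
    by (rule measurable_det_diff) measurable
  have "sets (H \<Otimes>\<^sub>M H) = sets (?U \<Otimes>\<^sub>M ?U)"
    by (intro sets_pair_measure_cong sets_H)
  then have "(\<lambda>q. det (snd q - fst q)) \<in> borel_measurable (H \<Otimes>\<^sub>M H)"
    using meas measurable_cong_sets[OF _ refl] by blast
  then have "{q \<in> space (H \<Otimes>\<^sub>M H). det (snd q - fst q) \<noteq> 0} \<in> sets (H \<Otimes>\<^sub>M H)"
    by measurable
  moreover have "AE B in H. AE A in H. det (snd (B, A) - fst (B, A)) \<noteq> 0"
    by (rule AE_I2) (simp add: space_H haar_singular_difference_null[OF H])
  ultimately have "AE q in H \<Otimes>\<^sub>M H. det (snd q - fst q) \<noteq> 0"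
    by (rule HH.AE_pair_measure[where P = "\<lambda>q. det (snd q - fst q) \<noteq> 0"])
  moreover have "{q \<in> space (?U \<Otimes>\<^sub>M ?U). det (snd q - fst q) \<noteq> 0} \<in> sets (?U \<Otimes>\<^sub>M ?U)"
    using meas by measurable
  ultimately show ?thesis
    unfolding joint
    by (subst (asm) AE_distr_iff[where P = "\<lambda>q. det (snd q - fst q) \<noteq> 0", OF rv]) simp_all
qed

text \<open>The disjoint index blocks \<open>{i}\<close> and \<open>{j}\<close> give independent
  restricted families; evaluating each at its single index recovers the two variables.\<close>

lemma (in prob_space) indep_vars_imp_indep_var:
  assumes "indep_vars N X I" "i \<in> I" "j \<in> I" "i \<noteq> j"
  shows "indep_var (N i) (X i) (N j) (X j)"
proof -
  have "indep_var (N i) ((\<lambda>f. f i) \<circ> (\<lambda>\<omega>. restrict (\<lambda>k. X k \<omega>) {i}))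
      (N j) ((\<lambda>f. f j) \<circ> (\<lambda>\<omega>. restrict (\<lambda>k. X k \<omega>) {j}))"
    using assms by (intro indep_var_compose[OF indep_var_restrict[OF assms(1)]]) auto
  then show ?thesis by (simp add: o_def)
qed

section \<open>From pairs to the whole constellation\<close>

text \<open>A minimum of finitely many nonnegative numbers is positive iff each is, and the root
  vanishes exactly when the determinant does, since \<open>0 powr x = 0\<close>. Bounding
  \<open>l\<close> by \<open>l'\<close> turns the condition into nested finite quantifiers, suited
  to measurability and almost-everywhere arguments.\<close>

lemma
  fixes \<Psi> :: "nat \<Rightarrow> complex^'n^'n"
  assumes "L \<ge> 2"
  shows diversity_product_pos_iff: "diversity_product L \<Psi> > 0 \<longleftrightarrow> (\<forall>l'\<in>{1..L}. \<forall>l\<in>{1..<l'}. det (\<Psi> l - \<Psi> l') \<noteq> 0)"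
    and diversity_product_nonneg: "diversity_product L \<Psi> \<ge> 0"
proof -
  let ?D = "{cmod (det (\<Psi> l - \<Psi> l')) powr (1 / real CARD('n)) | l l'. 1 \<le> l \<and> l < l' \<and> l' \<le> L}"
  have "?D \<subseteq> (\<lambda>(l, l'). cmod (det (\<Psi> l - \<Psi> l')) powr (1 / real CARD('n))) ` ({1..L} \<times> {1..L})"
    by force
  then have fin: "finite ?D"
    by (rule finite_subset) simp
  \<comment> \<open>The pair (1, 2) is a witness that the minimum is over a nonempty set.\<close>
  have "1 \<le> (1::nat) \<and> 1 < (2::nat) \<and> 2 \<le> L"
    using assms by simp
  then have ne: "?D \<noteq> {}" by blast
  have "Min ?D > 0 \<longleftrightarrow> (\<forall>d\<in>?D. d > 0)"
    using fin ne by simp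
  also have "\<dots> \<longleftrightarrow> (\<forall>l'\<in>{1..L}. \<forall>l\<in>{1..<l'}. det (\<Psi> l - \<Psi> l') \<noteq> 0)"
    by fastforce
  finally show "diversity_product L \<Psi> > 0 \<longleftrightarrow> (\<forall>l'\<in>{1..L}. \<forall>l\<in>{1..<l'}. det (\<Psi> l - \<Psi> l') \<noteq> 0)"
    by (simp add: diversity_product_def)
  have "Min ?D \<in> ?D"
    using fin ne by (rule Min_in)
  then have "Min ?D \<ge> 0" by auto
  then show "diversity_product L \<Psi> \<ge> 0"
    by (simp add: diversity_product_def)
qed

theorem theorem3p3:
  fixes P :: "'w measure"
    and H :: "(complex^'n^'n) measure"
    and U :: "nat \<Rightarrow> 'w \<Rightarrow> complex^'n^'n"
    and L :: nat
  assumes "prob_space P"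
    and "L \<ge> 2"
    and "is_haar_measure H"
    and "prob_space.indep_vars P (\<lambda>_. unitary_borel) U {1..L}"
    and "\<And>l. l \<in> {1..L} \<Longrightarrow> distr P unitary_borel (U l) = H"
  shows "\<P>(\<omega> in P. diversity_product L (\<lambda>l. U l \<omega>) = 0) = 0
    \<and> \<P>(\<omega> in P. fully_diverse L (\<lambda>l. U l \<omega>)) = 1"
proof -
  interpret prob_space P by fact
  have rv: "U l \<in> measurable P unitary_borel" if "l \<in> {1..L}" for l
    using assms(4) that by (simp add: indep_vars_def)
  let ?FD = "{\<omega> \<in> space P. fully_diverse L (\<lambda>l. U l \<omega>)}"
  have FD: "fully_diverse L (\<lambda>l. U l \<omega>) \<longleftrightarrow>
      (\<forall>l'\<in>{1..L}. \<forall>l\<in>{1..<l'}. det (U l \<omega> - U l' \<omega>) \<noteq> 0)" for \<omega>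
    unfolding fully_diverse_def by (rule diversity_product_pos_iff[OF assms(2)])
  have sets_FD: "?FD \<in> events"
    unfolding FD
  proof (intro sets.sets_Collect_finite_All)
    fix l l' assume "l' \<in> {1..L}" "l \<in> {1..<l'}"
    then have "(\<lambda>\<omega>. det (U l \<omega> - U l' \<omega>)) \<in> borel_measurable P"
      by (intro measurable_det_diff rv) auto
    then show "{\<omega> \<in> space P. det (U l \<omega> - U l' \<omega>) \<noteq> 0} \<in> events"
      by measurable
  qed auto
  have "AE \<omega> in P. det (U l \<omega> - U l' \<omega>) \<noteq> 0" if "l' \<in> {1..L}" "l \<in> {1..<l'}" for l l'
    using that assms(5)
    by (intro indep_haar_difference_nonsingular[OF assms(3)] indep_vars_imp_indep_var[OF assms(4)]) auto
  then have "AE \<omega> in P. fully_diverse L (\<lambda>l. U l \<omega>)"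
    unfolding FD by (intro AE_finite_allI) auto
  then have prob_FD: "prob ?FD = 1"
    using sets_FD by (subst prob_Collect_eq_1) auto
  \<comment> \<open>Since the diversity product is never negative, failing to be positive means
    being zero.\<close>
  moreover have "{\<omega> \<in> space P. diversity_product L (\<lambda>l. U l \<omega>) = 0} = space P - ?FD"
    using diversity_product_nonneg[OF assms(2)] by (auto simp: fully_diverse_def less_le)
  ultimately show ?thesis
    using prob_compl[OF sets_FD] by simp
qed

end
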